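(* Let $X$ be a graph with adjacency matrix $A$ and let $U(t)=\exp(itA)$. Let $P$ be a real density matrix with rows and columns indexed by $V(X)$, and write $P(t)=U(t)PU(-t)$. If $t$ is a real number such that $Q:=P(t)$ is real, then $P(2t)=P$ and $U(2t)$ commutes with $P$ and with $Q$.
   Context: Graphs are finite and undirected. A density matrix is a positive semidefinite (Hermitian) matrix with trace $1$; it is real if all its entries are real. *)

theory Defs
  imports "HOL-Analysis.Analysis"
begin

text \<open>A finite undirected graph is given by its adjacency relation on a finite type of vertices,
  which is required to be symmetric where it is used. Loops are not excluded.\<close>

definition adjacency_matrix :: "('v \<Rightarrow> 'v \<Rightarrow> bool) \<Rightarrow> complex^'v^'v::finite" where
  "adjacency_matrix adj = (\<chi> i j. of_bool (adj i j))"

text \<open>The product of the class \<open>times\<close> on \<open>'a^'n^'n\<close> is componentwise, so neither \<open>(^)\<close> nor \<open>exp\<close>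
  is the matrix operation; the matrix product is \<open>(**)\<close>.\<close>

primrec matrix_pow :: "complex^'n^'n \<Rightarrow> nat \<Rightarrow> complex^'n^'n::finite" where
  "matrix_pow M 0 = mat 1"
| "matrix_pow M (Suc k) = M ** matrix_pow M k"

definition matrix_exp :: "complex^'n^'n \<Rightarrow> complex^'n^'n::finite" where
  "matrix_exp M = (\<Sum>k. matrix_pow M k /\<^sub>R fact k)"

lemma norm_matrix_pow_entry_le:
  fixes M :: "complex^'n^'n::finite"
  shows "norm (matrix_pow M k $ i $ j) \<le> (real CARD('n) * norm M) ^ k"
proof (induction k arbitrary: i)
  case 0
  then show ?case by (simp add: mat_def)
next
  case (Suc k)
  have entry: "norm (M $ i $ l) \<le> norm M" for l
    using Finite_Cartesian_Product.norm_nth_le[of M i]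
      Finite_Cartesian_Product.norm_nth_le[of "M $ i" l] by linarith
  have "norm (matrix_pow M (Suc k) $ i $ j)
      \<le> (\<Sum>l\<in>UNIV. norm (M $ i $ l * matrix_pow M k $ l $ j))"
    by (simp add: matrix_matrix_mult_def norm_sum)
  also have "\<dots> \<le> (\<Sum>l\<in>(UNIV :: 'n set). norm M * (real CARD('n) * norm M) ^ k)"
    by (intro sum_mono) (simp add: norm_mult mult_mono entry Suc.IH)
  finally show ?case by simp
qed

lemma summable_matrix_exp:
  fixes M :: "complex^'n^'n::finite"
  shows "summable (\<lambda>k. matrix_pow M k /\<^sub>R fact k)"
proof (rule summable_comparison_test')
  let ?c = "real CARD('n) * norm M"
  show "summable (\<lambda>k. (real CARD('n) * real CARD('n)) * (?c ^ k /\<^sub>R fact k))"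
    by (intro summable_mult summable_exp_generic)
  fix k :: nat
  have "norm (matrix_pow M k) \<le> (\<Sum>i\<in>UNIV. norm (matrix_pow M k $ i))"
    by (simp add: norm_vec_def L2_set_le_sum)
  also have "\<dots> \<le> (\<Sum>i\<in>UNIV. \<Sum>j\<in>UNIV. norm (matrix_pow M k $ i $ j))"
    by (intro sum_mono) (simp add: norm_vec_def L2_set_le_sum)
  also have "\<dots> \<le> (\<Sum>i\<in>(UNIV :: 'n set). \<Sum>j\<in>(UNIV :: 'n set). ?c ^ k)"
    by (intro sum_mono norm_matrix_pow_entry_le)
  finally show "norm (matrix_pow M k /\<^sub>R fact k)
      \<le> (real CARD('n) * real CARD('n)) * (?c ^ k /\<^sub>R fact k)"
    by (simp add: divide_simps mult.assoc)
qed

definition transition_matrix :: "complex^'n^'n \<Rightarrow> real \<Rightarrow> complex^'n^'n::finite" where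
  "transition_matrix A t = matrix_exp (map_matrix (\<lambda>a. \<i> * of_real t * a) A)"

definition evolve :: "complex^'n^'n \<Rightarrow> complex^'n^'n \<Rightarrow> real \<Rightarrow> complex^'n^'n::finite" where
  "evolve A P t = transition_matrix A t ** P ** transition_matrix A (- t)"

definition hermitian :: "complex^'n^'n \<Rightarrow> bool" where
  "hermitian M \<longleftrightarrow> map_matrix cnj (transpose M) = M"

text \<open>The quadratic form of a Hermitian matrix takes real values, so only its real part is
  compared with 0.\<close>

definition positive_semidefinite :: "complex^'n^'n::finite \<Rightarrow> bool" where
  "positive_semidefinite M \<longleftrightarrow> hermitian M \<and>
     (\<forall>x :: complex^'n. 0 \<le> Re (\<Sum>i\<in>UNIV. cnj (x $ i) * (M *v x) $ i))"

definition density_matrix :: "complex^'n^'n::finite \<Rightarrow> bool" where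
  "density_matrix M \<longleftrightarrow> positive_semidefinite M \<and> trace M = 1"

definition real_matrix :: "complex^'n^'n \<Rightarrow> bool" where
  "real_matrix M \<longleftrightarrow> (\<forall>i j. M $ i $ j \<in> \<real>)"

end

theory Submission
  imports Defs
begin

text \<open>
  Since the adjacency matrix is real, entrywise conjugation sends \<open>U(t)\<close> to \<open>U(-t)\<close>. It fixes
  the real matrices \<open>P\<close> and \<open>Q\<close>, so conjugating \<open>Q = U(t) P U(-t)\<close> gives \<open>Q = U(-t) P U(t)\<close>:
  evolving \<open>P\<close> forwards and backwards by \<open>t\<close> has the same result. By the group law
  \<open>U(s) U(t) = U(s + t)\<close>, evolving that common result forwards by \<open>t\<close> turns its first
  expression into \<open>P(2t)\<close> and its second into \<open>P\<close>. Evolutions for different times commute,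
  so evolving by \<open>2t\<close> also fixes \<open>Q\<close>. Finally, a matrix fixed by evolution for time \<open>s\<close>
  commutes with \<open>U(s)\<close>: multiply \<open>U(s) M U(-s) = M\<close> by \<open>U(s)\<close> on the right.

  The two properties of the exponential behind this, compatibility with conjugation
  (\<open>cnj_transition_matrix\<close>) and the group law (\<open>transition_matrix_add\<close>), are obtained entry by
  entry from absolutely convergent complex series.
\<close>

lemma summable_norm_matrix_exp_entry:
  fixes M :: "complex^'n^'n::finite"
  shows "summable (\<lambda>k. norm (matrix_pow M k $ i $ j /\<^sub>R fact k))"
proof (rule summable_comparison_test')
  show "summable (\<lambda>k. (real CARD('n) * norm M) ^ k /\<^sub>R fact k)"
    by (rule summable_exp_generic)
  show "norm (norm (matrix_pow M k $ i $ j /\<^sub>R fact k)) \<le> (real CARD('n) * norm M) ^ k /\<^sub>R fact k"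
    for k
    using norm_matrix_pow_entry_le[of M k i j] by (simp add: divide_simps)
qed

lemma matrix_exp_entry_sums:
  fixes M :: "complex^'n^'n::finite"
  shows "(\<lambda>k. matrix_pow M k $ i $ j /\<^sub>R fact k) sums (matrix_exp M $ i $ j)"
proof -
  have "(\<lambda>k. matrix_pow M k /\<^sub>R fact k) sums matrix_exp M"
    unfolding matrix_exp_def by (rule summable_sums[OF summable_matrix_exp])
  then have "(\<lambda>k. (matrix_pow M k /\<^sub>R fact k) $ i $ j) sums (matrix_exp M $ i $ j)"
    by (intro bounded_linear.sums[OF bounded_linear_vec_nth])
  then show ?thesis by simp
qed

lemma map_matrix_cnj_mult:
  fixes M :: "complex^'n^'m" and N :: "complex^'p^'n::finite"
  shows "map_matrix cnj (M ** N) = map_matrix cnj M ** map_matrix cnj N"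
  by (simp add: vec_eq_iff matrix_matrix_mult_def)

lemma matrix_pow_cnj: "matrix_pow (map_matrix cnj M) k = map_matrix cnj (matrix_pow M k)"
proof (induction k)
  case 0
  show ?case by (simp add: vec_eq_iff mat_def)
qed (simp add: map_matrix_cnj_mult)

lemma matrix_exp_cnj: "matrix_exp (map_matrix cnj M) = map_matrix cnj (matrix_exp M)"
proof -
  have "matrix_exp (map_matrix cnj M) $ i $ j = cnj (matrix_exp M $ i $ j)" for i j
  proof (rule sums_unique2[OF matrix_exp_entry_sums])
    have "(\<lambda>k. cnj (matrix_pow M k $ i $ j /\<^sub>R fact k)) sums cnj (matrix_exp M $ i $ j)"
      using matrix_exp_entry_sums by (simp only: sums_cnj)
    then show "(\<lambda>k. matrix_pow (map_matrix cnj M) k $ i $ j /\<^sub>R fact k) sums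
        cnj (matrix_exp M $ i $ j)"
      by (simp add: matrix_pow_cnj)
  qed
  then show ?thesis by (simp add: vec_eq_iff)
qed

lemma matrix_pow_add: "matrix_pow M (m + n) = matrix_pow M m ** matrix_pow M n"
  by (induction m) (simp_all add: matrix_mul_assoc)

lemma matrix_pow_scale:
  "matrix_pow (map_matrix ((*) a) M) k = map_matrix ((*) (a ^ k)) (matrix_pow M k)"
proof (induction k)
  case 0
  show ?case by (simp add: vec_eq_iff)
next
  case (Suc k)
  show ?case
    unfolding matrix_pow.simps Suc.IH
    by (simp add: vec_eq_iff matrix_matrix_mult_def sum_distrib_left mult_ac)
qed

text \<open>Each summand of an entry of the product is a product of two absolutely convergent complex
  series, so it equals their Cauchy product. In the \<open>k\<close>-th coefficient, summing over the inner
  matrix index \<open>l\<close> merges the powers with exponents \<open>m\<close> and \<open>k - m\<close> into \<open>matrix_pow M k\<close>, and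
  the remaining scalar is the binomial expansion of \<open>(a + b) ^ k / fact k\<close>.\<close>

lemma matrix_exp_scale_add:
  fixes M :: "complex^'n^'n::finite"
  shows "matrix_exp (map_matrix ((*) a) M) ** matrix_exp (map_matrix ((*) b) M)
    = matrix_exp (map_matrix ((*) (a + b)) M)"
proof -
  let ?e = "\<lambda>c k i j. matrix_pow (map_matrix ((*) c) M) k $ i $ j /\<^sub>R fact k"
  let ?E = "\<lambda>c. matrix_exp (map_matrix ((*) c) M)"
  have coefficient: "(\<Sum>l\<in>UNIV. \<Sum>m\<le>k. ?e a m i l * ?e b (k - m) l j) = ?e (a + b) k i j" for i j k
  proof -
    have "(\<Sum>l\<in>UNIV. \<Sum>m\<le>k. ?e a m i l * ?e b (k - m) l j)
        = (\<Sum>m\<le>k. (a ^ m /\<^sub>R fact m) * (b ^ (k - m) /\<^sub>R fact (k - m))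
            * (\<Sum>l\<in>UNIV. matrix_pow M m $ i $ l * matrix_pow M (k - m) $ l $ j))"
      by (subst sum.swap) (simp add: matrix_pow_scale sum_distrib_left scaleR_conv_of_real mult_ac)
    also have "\<dots> = (\<Sum>m\<le>k. (a ^ m /\<^sub>R fact m) * (b ^ (k - m) /\<^sub>R fact (k - m))
            * matrix_pow M k $ i $ j)"
    proof (rule sum.cong[OF refl])
      fix m assume "m \<in> {..k}"
      then have "matrix_pow M k = matrix_pow M m ** matrix_pow M (k - m)"
        by (simp flip: matrix_pow_add)
      then have "(\<Sum>l\<in>UNIV. matrix_pow M m $ i $ l * matrix_pow M (k - m) $ l $ j)
          = matrix_pow M k $ i $ j"
        by (simp add: matrix_matrix_mult_def)
      then show "(a ^ m /\<^sub>R fact m) * (b ^ (k - m) /\<^sub>R fact (k - m))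
            * (\<Sum>l\<in>UNIV. matrix_pow M m $ i $ l * matrix_pow M (k - m) $ l $ j)
          = (a ^ m /\<^sub>R fact m) * (b ^ (k - m) /\<^sub>R fact (k - m)) * matrix_pow M k $ i $ j"
        by simp
    qed
    also have "\<dots> = ((a + b) ^ k /\<^sub>R fact k) * matrix_pow M k $ i $ j"
      by (simp only: exp_series_add_commuting[OF mult.commute] sum_distrib_right)
    finally show ?thesis by (simp add: matrix_pow_scale)
  qed
  have "(?E a ** ?E b) $ i $ j = ?E (a + b) $ i $ j" for i j
  proof (rule sums_unique2[OF _ matrix_exp_entry_sums])
    have "(\<lambda>k. \<Sum>m\<le>k. ?e a m i l * ?e b (k - m) l j) sums (?E a $ i $ l * ?E b $ l $ j)" for l
      using Cauchy_product_sums[OF summable_norm_matrix_exp_entry summable_norm_matrix_exp_entry,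
          of "map_matrix ((*) a) M" i l "map_matrix ((*) b) M" l j]
      by (simp only: sums_unique[OF matrix_exp_entry_sums, symmetric])
    then have "(\<lambda>k. \<Sum>l\<in>UNIV. \<Sum>m\<le>k. ?e a m i l * ?e b (k - m) l j)
        sums (\<Sum>l\<in>UNIV. ?E a $ i $ l * ?E b $ l $ j)"
      by (intro sums_sum)
    then show "(\<lambda>k. ?e (a + b) k i j) sums ((?E a ** ?E b) $ i $ j)"
      by (simp only: coefficient) (simp add: matrix_matrix_mult_def)
  qed
  then show ?thesis by (simp add: vec_eq_iff)
qed

lemma transition_matrix_add:
  "transition_matrix A s ** transition_matrix A t = transition_matrix A (s + t)"
  using matrix_exp_scale_add[of "\<i> * of_real s" A "\<i> * of_real t"]
  by (simp add: transition_matrix_def distrib_left)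

lemma transition_matrix_0: "transition_matrix A 0 = mat 1"
proof -
  have "matrix_pow (map_matrix (\<lambda>a. \<i> * of_real 0 * a) A) k /\<^sub>R fact k = (if k = 0 then mat 1 else 0)"
    for k
    by (cases k) (simp_all add: vec_eq_iff matrix_matrix_mult_def)
  then show ?thesis
    unfolding transition_matrix_def matrix_exp_def
    by (simp only: sums_unique[OF sums_single, symmetric])
qed

lemma real_matrix_iff_cnj: "real_matrix M \<longleftrightarrow> map_matrix cnj M = M"
  by (simp add: real_matrix_def vec_eq_iff Reals_cnj_iff)

lemma cnj_transition_matrix:
  assumes "real_matrix A"
  shows "map_matrix cnj (transition_matrix A t) = transition_matrix A (- t)"
proof -
  have "map_matrix cnj (map_matrix (\<lambda>a. \<i> * of_real t * a) A)
      = map_matrix (\<lambda>a. \<i> * of_real (- t) * a) A"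
    using assms by (simp add: real_matrix_iff_cnj vec_eq_iff)
  then show ?thesis
    by (simp add: transition_matrix_def flip: matrix_exp_cnj)
qed

lemma evolve_0: "evolve A P 0 = P"
  by (simp add: evolve_def transition_matrix_0)

lemma evolve_evolve: "evolve A (evolve A P s) t = evolve A P (s + t)"
proof -
  have "evolve A (evolve A P s) t = (transition_matrix A t ** transition_matrix A s) ** P
      ** (transition_matrix A (- s) ** transition_matrix A (- t))"
    by (simp add: evolve_def matrix_mul_assoc)
  then show ?thesis
    by (simp add: evolve_def transition_matrix_add add.commute)
qed

lemma cnj_evolve:
  assumes "real_matrix A" "real_matrix P"
  shows "map_matrix cnj (evolve A P t) = evolve A P (- t)"
  using assms(2)
  by (simp add: evolve_def map_matrix_cnj_mult cnj_transition_matrix[OF assms(1)] real_matrix_iff_cnj)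

lemma commute_if_evolve_eq:
  assumes "evolve A P t = P"
  shows "transition_matrix A t ** P = P ** transition_matrix A t"
proof -
  have "P ** transition_matrix A t
      = transition_matrix A t ** P ** (transition_matrix A (- t) ** transition_matrix A t)"
    using assms by (metis evolve_def matrix_mul_assoc)
  then show ?thesis
    by (simp add: transition_matrix_add transition_matrix_0)
qed

theorem lemma2p3:
  fixes adj :: "'v::finite \<Rightarrow> 'v \<Rightarrow> bool"
    and A P Q :: "complex^'v^'v"
    and U :: "real \<Rightarrow> complex^'v^'v"
    and t :: real
  assumes undirected: "symp adj"
    and A_def: "A = adjacency_matrix adj"
    and U_def: "U = transition_matrix A"
    and density: "density_matrix P"
    and real_P: "real_matrix P"
    and Q_def: "Q = evolve A P t"
    and real_Q: "real_matrix Q"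
  shows "evolve A P (2 * t) = P \<and>
         U (2 * t) ** P = P ** U (2 * t) \<and>
         U (2 * t) ** Q = Q ** U (2 * t)"
proof -
  have "real_matrix A"
    by (simp add: A_def adjacency_matrix_def real_matrix_def)
  then have backwards: "Q = evolve A P (- t)"
    using cnj_evolve[of A P t] real_P real_Q by (simp add: Q_def real_matrix_iff_cnj)
  have "evolve A P (2 * t) = evolve A Q t"
    by (simp add: Q_def evolve_evolve)
  also have "\<dots> = P"
    by (simp add: backwards evolve_evolve evolve_0)
  finally have period: "evolve A P (2 * t) = P" .
  have "evolve A Q (2 * t) = evolve A (evolve A P (2 * t)) t"
    by (simp add: Q_def evolve_evolve add.commute)
  then have "evolve A Q (2 * t) = Q"
    by (simp add: period Q_def)
  with period show ?thesis
    by (simp add: U_def commute_if_evolve_eq)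
qed

end
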